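(* Let $G$ be a finite group with $|G| = mp^k$, where $p$ is a prime, $k \geq 1$, and $m$ is a natural number such that $1 < m/q < p < m$, where $q$ is the smallest prime divisor of $m$. Then $m^*(G) > |G|$, and so $G$ is not Chermak-Delgado simple.
   Context: For $H \leq G$, $m_G(H) = |H|\,|C_G(H)|$; $m^*(G) = \max\{ m_G(H) : H \leq G\}$; $\mathcal{CD}(G) = \{ H \leq G : m_G(H) = m^*(G)\}$. $G$ is Chermak-Delgado simple if $\mathcal{CD}(G) = \{1, G\}$. *)

theory Defs
  imports "HOL-Algebra.Algebra"
begin

definition centralizer :: "('a, 'b) monoid_scheme \<Rightarrow> 'a set \<Rightarrow> 'a set" where
  "centralizer G H = {g \<in> carrier G. \<forall>h \<in> H. g \<otimes>\<^bsub>G\<^esub> h = h \<otimes>\<^bsub>G\<^esub> g}"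

definition cd_measure :: "('a, 'b) monoid_scheme \<Rightarrow> 'a set \<Rightarrow> nat" where
  "cd_measure G H = card H * card (centralizer G H)"

definition cd_max :: "('a, 'b) monoid_scheme \<Rightarrow> nat" where
  "cd_max G = Max {cd_measure G H | H. subgroup H G}"

definition CD_lattice :: "('a, 'b) monoid_scheme \<Rightarrow> 'a set set" where
  "CD_lattice G = {H. subgroup H G \<and> cd_measure G H = cd_max G}"

definition CD_simple :: "('a, 'b) monoid_scheme \<Rightarrow> bool" where
  "CD_simple G \<longleftrightarrow> CD_lattice G = {{\<one>\<^bsub>G\<^esub>}, carrier G}"

end

theory Submission
  imports Defs
begin

text \<open>
  Suppose that \<open>|H| |C(H)| \<le> |G|\<close> for all \<open>H\<close>. The hypotheses give \<open>p < m < p\<^sup>2\<close>, and every proper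
  divisor of \<open>m\<close> is less than \<open>p\<close>. Let \<open>P\<close> be a Sylow \<open>p\<close>-subgroup. If \<open>P\<close> is normal, then \<open>H = Z(P)\<close>
  shows \<open>|Z(P)| = p\<close>, so a nontrivial \<open>z\<close> in \<open>Z(P)\<close> has at most \<open>p - 1\<close> conjugates and its double
  centralizer has too large a measure. Otherwise \<open>P\<close> is a maximal subgroup, by counting products of
  subgroups, and it is the centralizer of each nontrivial element of \<open>Z(P)\<close>; two distinct Sylow
  subgroups \<open>P\<close> and \<open>Q\<close> meet in a normal subgroup \<open>D\<close> of index \<open>p\<close> in \<open>P\<close>. For \<open>D = 1\<close> the elements of
  order prime to \<open>p\<close> form an abelian subgroup of order \<open>m\<close>; for \<open>D \<noteq> 1\<close> the action on \<open>Z(D)\<close> forces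
  \<open>m = p + 1\<close>, and then an involution would normalize \<open>P\<close>.
\<close>

section \<open>Divisors of prime powers and counting by fibres\<close>

lemma dvd_prime_powerD:
  fixes p d :: nat
  assumes "Factorial_Ring.prime p" "d dvd p ^ k"
  obtains i where "i \<le> k" "d = p ^ i"
  using assms divides_primepow_nat by blast

text \<open>A proper divisor has a smaller exponent. In this product form the fact says that a
  proper subgroup of a \<open>p\<close>-group has index at least \<open>p\<close>.\<close>

lemma proper_dvd_prime_power:
  fixes p d :: nat
  assumes "Factorial_Ring.prime p" "d dvd p ^ k" "d \<noteq> p ^ k"
  shows "d * p \<le> p ^ k"
proof -
  obtain i where i: "i \<le> k" "d = p ^ i" using dvd_prime_powerD assms by blast
  with assms have "Suc i \<le> k" by (metis le_neq_implies_less Suc_leI)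
  then have "p ^ Suc i \<le> p ^ k" using assms(1) by (meson power_increasing prime_ge_1_nat)
  then show ?thesis using i by (simp add: mult.commute)
qed

text \<open>Common source of the counts of products, conjugacy classes and conjugates below: in each
  of them every fibre is in bijection with one fixed subgroup.\<close>

lemma card_fibres:
  assumes "finite A" and "\<And>a. a \<in> A \<Longrightarrow> card {x \<in> A. f x = f a} = c"
  shows "card (f ` A) * c = card A"
proof -
  have "card A = (\<Sum>x\<in>A. 1)" by simp
  also have "\<dots> = (\<Sum>y\<in>f ` A. \<Sum>x\<in>{x \<in> A. f x = y}. 1)"
    using assms(1) by (rule sum.image_gen)
  also have "\<dots> = (\<Sum>y\<in>f ` A. c)"
    by (rule sum.cong) (use assms(2) in auto)
  finally show ?thesis by simp
qed

context group
begin

section \<open>Conjugation, normalizers and centralizers\<close>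

definition conjugate :: "'a \<Rightarrow> 'a \<Rightarrow> 'a" where
  "conjugate g x = g \<otimes> x \<otimes> inv g"

text \<open>Only inclusion of the conjugate in \<open>S\<close> is required; for finite \<open>S\<close> it implies equality.\<close>

definition set_normalizer :: "'a set \<Rightarrow> 'a set" where
  "set_normalizer S = {g \<in> carrier G. \<forall>x\<in>S. conjugate g x \<in> S}"

lemma conjugate_closed [simp, intro]: "g \<in> carrier G \<Longrightarrow> x \<in> carrier G \<Longrightarrow> conjugate g x \<in> carrier G"
  by (simp add: conjugate_def)

lemma conjugate_mult: "g \<in> carrier G \<Longrightarrow> x \<in> carrier G \<Longrightarrow> y \<in> carrier G \<Longrightarrow> conjugate g (x \<otimes> y) = conjugate g x \<otimes> conjugate g y"
  by (simp add: conjugate_def m_assoc inv_solve_left)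

lemma conjugate_conjugate: "g \<in> carrier G \<Longrightarrow> h \<in> carrier G \<Longrightarrow> x \<in> carrier G \<Longrightarrow> conjugate g (conjugate h x) = conjugate (g \<otimes> h) x"
  by (simp add: conjugate_def m_assoc inv_mult_group)

lemma conjugate_one [simp]: "x \<in> carrier G \<Longrightarrow> conjugate \<one> x = x" "g \<in> carrier G \<Longrightarrow> conjugate g \<one> = \<one>"
  by (simp_all add: conjugate_def)

lemma conjugate_inv_conjugate [simp]: "g \<in> carrier G \<Longrightarrow> x \<in> carrier G \<Longrightarrow> conjugate (inv g) (conjugate g x) = x"
  "g \<in> carrier G \<Longrightarrow> x \<in> carrier G \<Longrightarrow> conjugate g (conjugate (inv g) x) = x"
  by (simp_all add: conjugate_conjugate)

lemma conjugate_inv: "g \<in> carrier G \<Longrightarrow> x \<in> carrier G \<Longrightarrow> conjugate g (inv x) = inv (conjugate g x)"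
  by (simp add: conjugate_def m_assoc inv_mult_group)

lemma conjugate_eq_self_iff: "g \<in> carrier G \<Longrightarrow> x \<in> carrier G \<Longrightarrow> conjugate g x = x \<longleftrightarrow> g \<otimes> x = x \<otimes> g"
  by (metis conjugate_def inv_solve_right m_closed)

lemma conjugate_inj: "g \<in> carrier G \<Longrightarrow> S \<subseteq> carrier G \<Longrightarrow> inj_on (conjugate g) S"
  by (rule inj_on_inverseI[where g = "conjugate (inv g)"]) auto

lemma conjugate_eq_one_iff: "g \<in> carrier G \<Longrightarrow> x \<in> carrier G \<Longrightarrow> conjugate g x = \<one> \<longleftrightarrow> x = \<one>"
  using inj_onD[OF conjugate_inj[of g "carrier G"], of x \<one>] by auto

lemma conjugate_mem_subgroup: "subgroup H G \<Longrightarrow> g \<in> H \<Longrightarrow> x \<in> H \<Longrightarrow> conjugate g x \<in> H"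
  by (simp add: conjugate_def subgroup.m_closed subgroup.m_inv_closed)

lemma subgroup_conjugate_image:
  assumes "subgroup H G" "g \<in> carrier G"
  shows "subgroup (conjugate g ` H) G"
proof (rule subgroupI)
  have H: "H \<subseteq> carrier G" using assms subgroup.subset by blast
  then show "conjugate g ` H \<subseteq> carrier G" using assms by auto
  show "conjugate g ` H \<noteq> {}" using assms subgroup.one_closed by blast
  show "inv x \<in> conjugate g ` H" if "x \<in> conjugate g ` H" for x
  proof -
    obtain h where h: "h \<in> H" "x = conjugate g h"
      using \<open>x \<in> conjugate g ` H\<close> by blast
    then have "inv x = conjugate g (inv h)" using assms H by (auto simp: conjugate_inv)
    then show ?thesis using h assms by (simp add: subgroup.m_inv_closed)
  qed
  show "x \<otimes> y \<in> conjugate g ` H" if "x \<in> conjugate g ` H" "y \<in> conjugate g ` H" for x y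
  proof -
    obtain h k where h: "h \<in> H" "x = conjugate g h" "k \<in> H" "y = conjugate g k"
      using \<open>x \<in> conjugate g ` H\<close> \<open>y \<in> conjugate g ` H\<close> by blast
    then have "x \<otimes> y = conjugate g (h \<otimes> k)"
      using assms H by (simp add: conjugate_mult subset_eq)
    then show ?thesis using h assms by (simp add: subgroup.m_closed)
  qed
qed

lemma card_conjugate_image: "g \<in> carrier G \<Longrightarrow> S \<subseteq> carrier G \<Longrightarrow> card (conjugate g ` S) = card S"
  by (simp add: card_image conjugate_inj)

lemma set_normalizer_subset: "set_normalizer S \<subseteq> carrier G"
  by (auto simp: set_normalizer_def)

lemma subgroup_subset_set_normalizer: "subgroup H G \<Longrightarrow> H \<subseteq> set_normalizer H"
  using subgroup.subset by (auto simp: set_normalizer_def conjugate_mem_subgroup)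

lemma set_normalizer_image_eq:
  assumes "finite S" "S \<subseteq> carrier G" "g \<in> set_normalizer S"
  shows "conjugate g ` S = S"
  using assms by (intro card_subset_eq) (auto simp: set_normalizer_def card_conjugate_image)

lemma subgroup_set_normalizer:
  assumes "finite S" "S \<subseteq> carrier G"
  shows "subgroup (set_normalizer S) G"
proof (rule subgroupI)
  show "set_normalizer S \<subseteq> carrier G" by (rule set_normalizer_subset)
  have "\<one> \<in> set_normalizer S" using assms by (auto simp: set_normalizer_def)
  then show "set_normalizer S \<noteq> {}" by blast
  show "inv g \<in> set_normalizer S" if "g \<in> set_normalizer S" for g
  proof -
    have "g \<in> carrier G" using that by (auto simp: set_normalizer_def)
    moreover have "conjugate (inv g) x \<in> S" if "x \<in> S" for x
    proof -
      have "x \<in> conjugate g ` S"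
        using set_normalizer_image_eq[OF assms \<open>g \<in> set_normalizer S\<close>] that by simp
      then obtain s where s: "s \<in> S" "x = conjugate g s" by blast
      then have "conjugate (inv g) x = s"
        using assms \<open>g \<in> carrier G\<close> by (simp add: subset_eq)
      then show ?thesis using s by simp
    qed
    ultimately show ?thesis by (simp add: set_normalizer_def)
  qed
  show "g \<otimes> h \<in> set_normalizer S" if "g \<in> set_normalizer S" "h \<in> set_normalizer S" for g h
  proof -
    have "conjugate (g \<otimes> h) x = conjugate g (conjugate h x)" if "x \<in> S" for x
      using that \<open>g \<in> set_normalizer S\<close> \<open>h \<in> set_normalizer S\<close> assms by (auto simp: set_normalizer_def conjugate_conjugate)
    then show ?thesis using that by (simp add: set_normalizer_def)
  qed
qed

lemma centralizer_iff_conjugate: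
  "S \<subseteq> carrier G \<Longrightarrow> g \<in> centralizer G S \<longleftrightarrow> g \<in> carrier G \<and> (\<forall>x\<in>S. conjugate g x = x)"
  by (auto simp: centralizer_def conjugate_eq_self_iff subset_eq)

lemma centralizer_subset: "centralizer G S \<subseteq> carrier G"
  by (auto simp: centralizer_def)

lemma subgroup_centralizer:
  assumes "S \<subseteq> carrier G"
  shows "subgroup (centralizer G S) G"
proof (rule subgroupI)
  show "centralizer G S \<subseteq> carrier G" by (rule centralizer_subset)
  have "\<one> \<in> centralizer G S" using assms by (auto simp: centralizer_iff_conjugate)
  then show "centralizer G S \<noteq> {}" by blast
  show "inv g \<in> centralizer G S" if "g \<in> centralizer G S" for g
  proof -
    have "conjugate (inv g) x = x" if "x \<in> S" for x
    proof -
      have "g \<in> carrier G" "x \<in> carrier G" "conjugate g x = x"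
        using that \<open>g \<in> centralizer G S\<close> assms by (auto simp: centralizer_iff_conjugate)
      then show ?thesis using conjugate_inv_conjugate(1)[of g x] by simp
    qed
    then show ?thesis using that assms by (simp add: centralizer_iff_conjugate)
  qed
  show "g \<otimes> h \<in> centralizer G S" if "g \<in> centralizer G S" "h \<in> centralizer G S" for g h
  proof -
    have "conjugate (g \<otimes> h) x = x" if "x \<in> S" for x
      using that \<open>g \<in> centralizer G S\<close> \<open>h \<in> centralizer G S\<close> assms conjugate_conjugate[of g h x]
      by (auto simp: centralizer_iff_conjugate)
    then show ?thesis using that assms by (simp add: centralizer_iff_conjugate)
  qed
qed

lemma centralizer_antimono: "S \<subseteq> T \<Longrightarrow> centralizer G T \<subseteq> centralizer G S"
  by (auto simp: centralizer_def)

lemma subset_centralizer_centralizer: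
  "S \<subseteq> carrier G \<Longrightarrow> S \<subseteq> centralizer G (centralizer G S)"
  unfolding centralizer_def by (auto simp: subset_eq)

text \<open>Taking centralizers is an order-reversing Galois connection. Hence a double centralizer
  has a known centralizer, which makes it a good candidate for a large measure.\<close>

lemma centralizer_centralizer_centralizer:
  assumes "S \<subseteq> carrier G"
  shows "centralizer G (centralizer G (centralizer G S)) = centralizer G S"
proof
  show "centralizer G (centralizer G (centralizer G S)) \<subseteq> centralizer G S"
    by (rule centralizer_antimono) (rule subset_centralizer_centralizer[OF assms])
  show "centralizer G S \<subseteq> centralizer G (centralizer G (centralizer G S))"
    by (rule subset_centralizer_centralizer) (rule centralizer_subset)
qed

text \<open>One inclusion holds because conjugation is multiplicative; the other is the same
  inclusion for \<open>inv g\<close> and the conjugated set.\<close>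

lemma conjugate_centralizer:
  assumes "S \<subseteq> carrier G" "g \<in> carrier G"
  shows "conjugate g ` centralizer G S = centralizer G (conjugate g ` S)"
proof -
  have *: "conjugate h ` centralizer G T \<subseteq> centralizer G (conjugate h ` T)"
    if "T \<subseteq> carrier G" "h \<in> carrier G" for h T
    using that by (auto simp: centralizer_def conjugate_mult[symmetric] subset_eq)
  have "conjugate (inv g) ` conjugate g ` S = S" using assms by (force simp: image_image subset_eq)
  then have sub: "conjugate (inv g) ` centralizer G (conjugate g ` S) \<subseteq> centralizer G S"
    using *[of "conjugate g ` S" "inv g"] assms by (auto simp: subset_eq)
  have "x \<in> conjugate g ` centralizer G S" if "x \<in> centralizer G (conjugate g ` S)" for x
  proof (rule image_eqI)
    show "conjugate (inv g) x \<in> centralizer G S" using sub that by blast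
    show "x = conjugate g (conjugate (inv g) x)"
      using that assms centralizer_subset by (metis conjugate_inv_conjugate(2) subsetD)
  qed
  then show ?thesis using * assms by blast
qed

text \<open>Together with \<open>set_normalizer_Int\<close> this makes the centre of a normal
  subgroup normal.\<close>

lemma set_normalizer_centralizer:
  assumes "finite S" "S \<subseteq> carrier G"
  shows "set_normalizer S \<subseteq> set_normalizer (centralizer G S)"
proof
  fix g assume g: "g \<in> set_normalizer S"
  then have gc: "g \<in> carrier G" by (simp add: set_normalizer_def)
  have "conjugate g ` centralizer G S = centralizer G S"
    using conjugate_centralizer[OF assms(2) gc] set_normalizer_image_eq[OF assms g] by simp
  then show "g \<in> set_normalizer (centralizer G S)"
    using g by (auto simp: set_normalizer_def)
qed

lemma set_normalizer_Int: "set_normalizer S \<inter> set_normalizer T \<subseteq> set_normalizer (S \<inter> T)"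
  by (auto simp: set_normalizer_def)

section \<open>Counting in finite groups and actions of \<open>p\<close>-groups\<close>

lemma card_subgroup_dvd:
  assumes "subgroup H G" "subgroup K G" "H \<subseteq> K"
  shows "card H dvd card K"
proof -
  interpret K: group "G\<lparr>carrier := K\<rparr>" using assms subgroup_imp_group by blast
  have "card (rcosets\<^bsub>G\<lparr>carrier := K\<rparr>\<^esub> H) * card H = card K"
    using K.lagrange[OF subgroup_incl[OF assms]] by (simp add: order_def)
  then show ?thesis by (rule dvdI[OF trans[OF sym mult.commute]])
qed

text \<open>The fibre of multiplication over \<open>h \<otimes> k\<close> consists of the pairs
  \<open>(h \<otimes> d, inv d \<otimes> k)\<close> with \<open>d\<close> in
  \<open>H \<inter> K\<close>.\<close>

lemma card_set_mult_Int:
  assumes H: "subgroup H G" and K: "subgroup K G" and fin: "finite (carrier G)"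
  shows "card (H <#> K) * card (H \<inter> K) = card H * card K"
proof -
  let ?f = "\<lambda>(h, k). h \<otimes> k"
  have sub: "H \<subseteq> carrier G" "K \<subseteq> carrier G" using H K subgroup.subset by blast+
  have "card (?f ` (H \<times> K)) * card (H \<inter> K) = card (H \<times> K)"
  proof (rule card_fibres)
    show "finite (H \<times> K)" using sub fin by (simp add: finite_subset)
    fix a assume "a \<in> H \<times> K"
    then obtain h k where a: "a = (h, k)" "h \<in> H" "k \<in> K" by auto
    then have hk: "h \<in> carrier G" "k \<in> carrier G" using sub by auto
    have "bij_betw (\<lambda>d. (h \<otimes> d, inv d \<otimes> k)) (H \<inter> K) {x \<in> H \<times> K. ?f x = ?f a}"
    proof (rule bij_betw_byWitness[where f' = "\<lambda>(x, y). inv h \<otimes> x"])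
      have cancel: "inv h \<otimes> (h \<otimes> d) = d" "h \<otimes> (inv h \<otimes> d) = d" if "d \<in> carrier G" for d
        using that hk by (simp_all add: m_assoc[symmetric])
      then show "\<forall>d\<in>H \<inter> K. (\<lambda>(x, y). inv h \<otimes> x) (h \<otimes> d, inv d \<otimes> k) = d"
        using sub by auto
      have eq: "inv (inv h \<otimes> x) \<otimes> k = y" if "x \<in> H" "y \<in> K" "x \<otimes> y = h \<otimes> k" for x y
      proof -
        have c: "x \<in> carrier G" "y \<in> carrier G" using that sub by auto
        have "inv (inv h \<otimes> x) \<otimes> k = inv x \<otimes> (h \<otimes> k)"
          using c hk by (simp add: inv_mult_group m_assoc)
        also have "\<dots> = inv x \<otimes> (x \<otimes> y)" using that by simp
        also have "\<dots> = y" using c by (simp add: m_assoc[symmetric])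
        finally show ?thesis .
      qed
      show "\<forall>z\<in>{x \<in> H \<times> K. ?f x = ?f a}.
          (\<lambda>d. (h \<otimes> d, inv d \<otimes> k)) ((\<lambda>(x, y). inv h \<otimes> x) z) = z"
      proof
        fix z assume "z \<in> {x \<in> H \<times> K. ?f x = ?f a}"
        then obtain x y where xy: "z = (x, y)" "x \<in> H" "y \<in> K" "x \<otimes> y = h \<otimes> k"
          using a by auto
        then have "h \<otimes> (inv h \<otimes> x) = x" using cancel sub by blast
        then show "(\<lambda>d. (h \<otimes> d, inv d \<otimes> k)) ((\<lambda>(x, y). inv h \<otimes> x) z) = z"
          using xy eq by simp
      qed
      show "(\<lambda>d. (h \<otimes> d, inv d \<otimes> k)) ` (H \<inter> K) \<subseteq> {x \<in> H \<times> K. ?f x = ?f a}"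
      proof (rule image_subsetI)
        fix d assume "d \<in> H \<inter> K"
        then have d: "d \<in> H" "d \<in> K" by auto
        then have dc: "d \<in> carrier G" using sub by blast
        then have "d \<otimes> (inv d \<otimes> k) = k" using hk by (simp add: m_assoc[symmetric])
        then have "h \<otimes> d \<otimes> (inv d \<otimes> k) = h \<otimes> k"
          using hk dc by (simp add: m_assoc)
        moreover have "h \<otimes> d \<in> H" "inv d \<otimes> k \<in> K"
          using a d H K by (simp_all add: subgroup.m_closed subgroup.m_inv_closed)
        ultimately show "(h \<otimes> d, inv d \<otimes> k) \<in> {x \<in> H \<times> K. ?f x = ?f a}"
          using a by simp
      qed
      show "(\<lambda>(x, y). inv h \<otimes> x) ` {x \<in> H \<times> K. ?f x = ?f a} \<subseteq> H \<inter> K"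
      proof (rule image_subsetI)
        fix z assume "z \<in> {x \<in> H \<times> K. ?f x = ?f a}"
        then obtain x y where xy: "z = (x, y)" "x \<in> H" "y \<in> K" "?f (x, y) = ?f a" by auto
        have c: "x \<in> carrier G" "y \<in> carrier G" using xy sub by auto
        have "inv h \<otimes> x = inv h \<otimes> (x \<otimes> y) \<otimes> inv y"
          using c hk by (simp add: m_assoc)
        also have "\<dots> = inv h \<otimes> (h \<otimes> k) \<otimes> inv y" using xy a by simp
        also have "\<dots> = k \<otimes> inv y" using c hk by (simp add: m_assoc[symmetric])
        finally have "inv h \<otimes> x = k \<otimes> inv y" .
        moreover have "inv h \<otimes> x \<in> H" "k \<otimes> inv y \<in> K" using xy a H K
          by (auto simp: subgroup.m_closed subgroup.m_inv_closed)
        ultimately show "(case z of (x, y) \<Rightarrow> inv h \<otimes> x) \<in> H \<inter> K"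
          using xy by simp
      qed
    qed
    then show "card {x \<in> H \<times> K. ?f x = ?f a} = card (H \<inter> K)"
      by (simp add: bij_betw_same_card)
  qed
  moreover have "?f ` (H \<times> K) = H <#> K" by (auto simp: set_mult_def)
  ultimately show ?thesis by (simp add: card_cartesian_product)
qed

lemma card_mult_le_Int:
  assumes "subgroup H G" "subgroup K G" "subgroup M G" "H \<subseteq> M" "K \<subseteq> M" "finite (carrier G)"
  shows "card H * card K \<le> card M * card (H \<inter> K)"
proof -
  have "H <#> K \<subseteq> M"
    using assms by (auto simp: set_mult_def subset_eq subgroup.m_closed[of M])
  then have "card (H <#> K) \<le> card M"
    using assms by (meson card_mono finite_subset subgroup.subset)
  then show ?thesis using card_set_mult_Int[of H K] assms by (metis mult_le_mono1)
qed

text \<open>Orbit-stabilizer for \<open>M\<close> acting by conjugation: the fibres are the left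
  cosets in \<open>M\<close> of the stabilizer of \<open>x\<close>.\<close>

lemma card_conj_class:
  assumes M: "subgroup M G" and x: "x \<in> carrier G" and fin: "finite (carrier G)"
  shows "card ((\<lambda>g. conjugate g x) ` M) * card (M \<inter> centralizer G {x}) = card M"
proof (rule card_fibres)
  have sub: "M \<subseteq> carrier G" using M subgroup.subset by blast
  then show "finite M" using fin finite_subset by blast
  fix g assume g: "g \<in> M"
  then have gc: "g \<in> carrier G" using sub by blast
  have "bij_betw (\<lambda>h. g \<otimes> h) (M \<inter> centralizer G {x}) {h \<in> M. conjugate h x = conjugate g x}"
  proof (rule bij_betw_byWitness[where f' = "\<lambda>h. inv g \<otimes> h"])
    show "\<forall>a\<in>M \<inter> centralizer G {x}. inv g \<otimes> (g \<otimes> a) = a"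
      using gc sub by (auto simp: m_assoc[symmetric])
    show "\<forall>a'\<in>{h \<in> M. conjugate h x = conjugate g x}. g \<otimes> (inv g \<otimes> a') = a'"
      using gc sub by (auto simp: m_assoc[symmetric])
    show "(\<lambda>h. g \<otimes> h) ` (M \<inter> centralizer G {x}) \<subseteq> {h \<in> M. conjugate h x = conjugate g x}"
      using g gc M x sub by (auto simp: centralizer_iff_conjugate subgroup.m_closed conjugate_conjugate[symmetric])
    show "(\<lambda>h. inv g \<otimes> h) ` {h \<in> M. conjugate h x = conjugate g x} \<subseteq> M \<inter> centralizer G {x}"
      using g gc M x sub
      by (auto simp: centralizer_iff_conjugate subgroup.m_closed subgroup.m_inv_closed conjugate_conjugate[symmetric] subset_eq)
  qed
  then show "card {h \<in> M. conjugate h x = conjugate g x} = card (M \<inter> centralizer G {x})"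
    by (simp add: bij_betw_same_card)
qed

text \<open>The points of \<open>V\<close> moved by the \<open>p\<close>-group \<open>M\<close> fall
  into orbits whose lengths are powers of \<open>p\<close> other than 1, so the number of fixed
  points is congruent to \<open>card V\<close> modulo \<open>p\<close>.\<close>

lemma prime_dvd_card_fixed_points:
  assumes p: "Factorial_Ring.prime p" and M: "subgroup M G" "card M = p ^ k"
    and V: "V \<subseteq> carrier G" "M \<subseteq> set_normalizer V" "p dvd card V" and fin: "finite (carrier G)"
  shows "p dvd card (V \<inter> centralizer G M)"
proof -
  have sub: "M \<subseteq> carrier G" using M subgroup.subset by blast
  have finV: "finite V" using V fin finite_subset by blast
  let ?O = "\<lambda>x. (\<lambda>g. conjugate g x) ` M"
  have orb: "?O x = ?O y" if "y \<in> ?O x" "x \<in> V" for x y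
  proof -
    obtain g where g: "g \<in> M" "y = conjugate g x" using \<open>y \<in> ?O x\<close> by auto
    have c: "g \<in> carrier G" "x \<in> carrier G" using g that sub V by auto
    have "conjugate h x \<in> ?O y" if "h \<in> M" for h
      by (rule image_eqI[where x = "h \<otimes> inv g"])
        (use g c that sub M in \<open>auto simp: conjugate_conjugate subset_eq m_assoc subgroup.m_closed subgroup.m_inv_closed\<close>)
    moreover have "conjugate h y \<in> ?O x" if "h \<in> M" for h
      by (rule image_eqI[where x = "h \<otimes> g"])
        (use g c that sub M in \<open>auto simp: conjugate_conjugate subset_eq subgroup.m_closed\<close>)
    ultimately show ?thesis by blast
  qed
  have self: "x \<in> ?O x" if "x \<in> V" for x
    using that V M by (intro image_eqI[where x = \<one>]) (auto simp: subgroup.one_closed)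
  have OV: "?O x \<subseteq> V" if "x \<in> V" for x
    using that V by (auto simp: set_normalizer_def)
  let ?W = "V - centralizer G M"
  \<comment> \<open>If the orbit of \<open>x\<close> contained a fixed point \<open>y\<close>, it
    would be the orbit of \<open>y\<close>, hence \<open>{y}\<close>, and \<open>x\<close> would be
    fixed as well.\<close>
  have moved: "?O x \<subseteq> ?W" if "x \<in> ?W" for x
  proof
    fix y assume y: "y \<in> ?O x"
    have "x \<in> centralizer G M" if yc: "y \<in> centralizer G M"
    proof -
      have "y \<in> carrier G" using yc centralizer_subset by blast
      have "conjugate h y = y" if "h \<in> M" for h
        using yc that sub \<open>y \<in> carrier G\<close> by (subst conjugate_eq_self_iff) (auto simp: centralizer_def)
      then have "?O y \<subseteq> {y}" by auto
      moreover have "?O x = ?O y" using orb y \<open>x \<in> ?W\<close> by blast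
      ultimately have "x = y" using self[of x] \<open>x \<in> ?W\<close> by blast
      then show ?thesis using yc by simp
    qed
    then show "y \<in> ?W" using OV y that by blast
  qed
  have "p dvd card (\<Union>(?O ` ?W))"
  proof (rule dvd_partition)
    show "finite (\<Union>(?O ` ?W))"
      using moved finV by (meson Diff_subset UN_least finite_subset subset_trans)
    show "\<forall>c\<in>?O ` ?W. p dvd card c"
    proof
      fix c assume "c \<in> ?O ` ?W"
      then obtain x where x: "x \<in> ?W" "c = ?O x" by auto
      have xc: "x \<in> carrier G" using x V by auto
      have eq: "card c * card (M \<inter> centralizer G {x}) = p ^ k"
        using card_conj_class[OF M(1) xc fin] x M by simp
      have "card c \<noteq> 1"
      proof
        assume "card c = 1"
        then obtain y where "c = {y}" using card_1_singletonE by blast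
        then have "c = {x}" using self[of x] x by simp
        then have "conjugate g x = x" if "g \<in> M" for g using x that by blast
        then have "g \<otimes> x = x \<otimes> g" if "g \<in> M" for g
          using that sub xc conjugate_eq_self_iff by blast
        then have "x \<in> centralizer G M" using xc by (auto simp: centralizer_def)
        then show False using x by blast
      qed
      moreover obtain i where "card c = p ^ i" using dvd_prime_powerD[OF p] eq by (metis dvd_triv_left)
      ultimately show "p dvd card c" by (cases i) auto
    qed
    show "\<forall>c1\<in>?O ` ?W. \<forall>c2\<in>?O ` ?W. c1 \<noteq> c2 \<longrightarrow> c1 \<inter> c2 = {}"
    proof (intro ballI impI, rule ccontr)
      fix c1 c2 assume "c1 \<in> ?O ` ?W" "c2 \<in> ?O ` ?W" "c1 \<noteq> c2" "c1 \<inter> c2 \<noteq> {}"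
      then obtain x y z where "x \<in> V" "y \<in> V" "c1 = ?O x" "c2 = ?O y" "z \<in> c1" "z \<in> c2" by blast
      then show False using orb \<open>c1 \<noteq> c2\<close> by metis
    qed
  qed
  moreover have "\<Union>(?O ` ?W) = ?W"
  proof
    show "\<Union>(?O ` ?W) \<subseteq> ?W" using moved by (rule UN_least)
    show "?W \<subseteq> \<Union>(?O ` ?W)" using self by blast
  qed
  ultimately have "p dvd card ?W" by simp
  moreover have "card V = card (V \<inter> centralizer G M) + card ?W"
    by (rule card_Int_Diff[OF finV])
  ultimately show ?thesis using V(3) by (simp add: dvd_add_left_iff)
qed

text \<open>If a conjugate \<open>?E\<close> of \<open>D\<close> by \<open>x\<close> in
  \<open>P\<close> differed from \<open>D\<close>, the product count would give
  \<open>D <#> ?E\<close> at least \<open>p ^ Suc j\<close> elements, hence all of \<open>P\<close>.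
  Writing \<open>inv x\<close> as such a product then puts \<open>x\<close> into
  \<open>D\<close>.\<close>

lemma index_prime_subset_set_normalizer:
  assumes p: "Factorial_Ring.prime p" and P: "subgroup P G" "card P = p ^ Suc j"
    and D: "subgroup D G" "card D = p ^ j" "D \<subseteq> P" and fin: "finite (carrier G)"
  shows "P \<subseteq> set_normalizer D"
proof
  fix x assume x: "x \<in> P"
  have subs: "P \<subseteq> carrier G" "D \<subseteq> carrier G" using P D subgroup.subset by blast+
  then have xc: "x \<in> carrier G" using x by blast
  have finP: "finite P" "finite D" using subs fin by (simp_all add: finite_subset)
  let ?E = "conjugate x ` D"
  have E: "subgroup ?E G" "card ?E = p ^ j"
    using subgroup_conjugate_image[OF D(1) xc] card_conjugate_image[OF xc subs(2)] D by simp_all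
  have EP: "?E \<subseteq> P" using x D(3) conjugate_mem_subgroup[OF P(1) x] by blast
  show "x \<in> set_normalizer D"
  proof (cases "D \<inter> ?E = D")
    case True
    then have "?E = D" using E D finP by (metis Int_lower2 card_subset_eq finite_imageI)
    then show ?thesis using xc by (auto simp: set_normalizer_def)
  next
    case False
    have I: "subgroup (D \<inter> ?E) G" using D E subgroups_Inter_pair by blast
    have "card (D \<inter> ?E) dvd p ^ j" using card_subgroup_dvd[OF I D(1)] D by simp
    moreover have "card (D \<inter> ?E) \<noteq> p ^ j"
      using False finP D by (metis card_subset_eq Int_lower1)
    ultimately have le: "card (D \<inter> ?E) * p \<le> p ^ j" using p proper_dvd_prime_power by blast
    have pos: "card (D \<inter> ?E) > 0"
      using subgroup.finite_imp_card_positive[OF I fin] .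
    have "card (D <#> ?E) * card (D \<inter> ?E) = p ^ j * p ^ j"
      using card_set_mult_Int[OF D(1) E(1) fin] D E by simp
    moreover have "p ^ j * (card (D \<inter> ?E) * p) \<le> p ^ j * p ^ j"
      using le by (rule mult_le_mono2)
    ultimately have "p ^ Suc j * card (D \<inter> ?E) \<le> card (D <#> ?E) * card (D \<inter> ?E)"
      by (simp add: ac_simps)
    then have "card P \<le> card (D <#> ?E)" using pos P by simp
    moreover have "D <#> ?E \<subseteq> P"
      using D EP P by (auto simp: set_mult_def subgroup.m_closed subset_eq)
    ultimately have "D <#> ?E = P" using finP by (simp add: card_seteq)
    moreover have "inv x \<in> P" using x P by (simp add: subgroup.m_inv_closed)
    ultimately obtain d e where de: "d \<in> D" "e \<in> D" "inv x = d \<otimes> conjugate x e"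
      by (auto simp: set_mult_def)
    have c: "d \<in> carrier G" "e \<in> carrier G" using de subs by auto
    \<comment> \<open>The relation reads
      \<open>inv x = d \<otimes> x \<otimes> e \<otimes> inv x\<close>; cancelling
      \<open>inv x\<close> on the right expresses \<open>x\<close> through \<open>d\<close> and
      \<open>e\<close>.\<close>
    have "\<one> \<otimes> inv x = d \<otimes> x \<otimes> e \<otimes> inv x"
      using de c xc by (simp add: conjugate_def m_assoc)
    then have "d \<otimes> x \<otimes> e = \<one>"
      using c xc by (metis inv_closed m_closed one_closed r_cancel)
    moreover have "inv d \<otimes> (d \<otimes> x \<otimes> e) \<otimes> inv e = inv d \<otimes> (d \<otimes> x)"
      using c xc by (simp add: m_assoc)
    then have "inv d \<otimes> (d \<otimes> x \<otimes> e) \<otimes> inv e = x"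
      using c xc by (simp add: m_assoc[symmetric])
    ultimately have "x = inv d \<otimes> inv e" using c by simp
    then have "x \<in> D" using de D by (simp add: subgroup.m_closed subgroup.m_inv_closed)
    then show ?thesis using subgroup_subset_set_normalizer D by blast
  qed
qed

text \<open>An element conjugating one member of \<open>L\<close> to another normalizes \<open>P\<close>, hence lies in \<open>P\<close>
  and fixes \<open>L\<close> pointwise; so the fibres of \<open>(g, l) \<mapsto> g l g\<^sup>-\<^sup>1\<close> are cosets of \<open>P\<close>.\<close>

lemma card_conjugates:
  assumes P: "subgroup P G" "set_normalizer P = P" and fin: "finite (carrier G)"
    and L: "L \<subseteq> carrier G" "\<And>l. l \<in> L \<Longrightarrow> centralizer G {l} = P"
  shows "card ((\<lambda>(g, l). conjugate g l) ` (carrier G \<times> L)) * card P = order G * card L"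
proof -
  let ?f = "\<lambda>(g, l). conjugate g l"
  have sub: "P \<subseteq> carrier G" using P subgroup.subset by blast
  have "card (?f ` (carrier G \<times> L)) * card P = card (carrier G \<times> L)"
  proof (rule card_fibres)
    show "finite (carrier G \<times> L)" using fin L by (simp add: finite_subset)
    fix a assume "a \<in> carrier G \<times> L"
    then obtain g l where a: "a = (g, l)" "g \<in> carrier G" "l \<in> L" by auto
    have fixP: "conjugate h l = l" if "h \<in> P" for h
    proof -
      have "h \<in> centralizer G {l}" using that L(2)[OF a(3)] by simp
      then show ?thesis using L(1) a(3) by (auto simp: centralizer_iff_conjugate subset_eq)
    qed
    have key: "inv g \<otimes> h \<in> P \<and> l' = l" if h: "h \<in> carrier G" "l' \<in> L" "conjugate h l' = conjugate g l" for h l'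
    proof -
      let ?u = "inv g \<otimes> h"
      have u: "?u \<in> carrier G" using a h by simp
      have l: "l \<in> carrier G" "l' \<in> carrier G" using L a h by auto
      have ul: "conjugate ?u l' = l" using h a l by (simp add: conjugate_conjugate[symmetric])
      have "conjugate ?u ` P = P" using conjugate_centralizer[of "{l'}" ?u] l u ul L(2) a h by simp
      then have "?u \<in> set_normalizer P" using u by (auto simp: set_normalizer_def)
      then have "?u \<in> P" using P by simp
      moreover have "?u \<in> centralizer G {l'}" using \<open>?u \<in> P\<close> L(2) h by simp
      ultimately show ?thesis using ul l by (simp add: centralizer_iff_conjugate)
    qed
    have "bij_betw (\<lambda>h. (g \<otimes> h, l)) P {x \<in> carrier G \<times> L. ?f x = ?f a}"
    proof (rule bij_betw_byWitness[where f' = "\<lambda>(h, l'). inv g \<otimes> h"])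
      show "\<forall>h\<in>P. (case (g \<otimes> h, l) of (h, l') \<Rightarrow> inv g \<otimes> h) = h"
        using a sub by (auto simp: m_assoc[symmetric])
      show "\<forall>x\<in>{x \<in> carrier G \<times> L. ?f x = ?f a}. (g \<otimes> (case x of (h, l') \<Rightarrow> inv g \<otimes> h), l) = x"
        using a key by (auto simp: m_assoc[symmetric])
      show "(\<lambda>h. (g \<otimes> h, l)) ` P \<subseteq> {x \<in> carrier G \<times> L. ?f x = ?f a}"
        using a sub fixP L by (auto simp: conjugate_conjugate[symmetric] subset_eq)
      show "(\<lambda>(h, l'). inv g \<otimes> h) ` {x \<in> carrier G \<times> L. ?f x = ?f a} \<subseteq> P"
        using a key by auto
    qed
    then show "card {x \<in> carrier G \<times> L. ?f x = ?f a} = card P"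
      by (simp add: bij_betw_same_card)
  qed
  then show ?thesis by (simp add: card_cartesian_product order_def)
qed

text \<open>The intersection \<open>P \<inter> H\<close> is a nontrivial \<open>p\<close>-group.
  Membership of \<open>z\<close> in a \<open>p\<close>-subgroup takes the place of a condition on
  the order of \<open>z\<close>.\<close>

lemma prime_dvd_card_subgroup:
  assumes p: "Factorial_Ring.prime p" and P: "subgroup P G" "card P = p ^ j"
    and H: "subgroup H G" and z: "z \<in> P" "z \<in> H" "z \<noteq> \<one>"
  shows "p dvd card H"
proof -
  have I: "subgroup (P \<inter> H) G" using P H subgroups_Inter_pair by blast
  have "card (P \<inter> H) dvd p ^ j" using card_subgroup_dvd[OF I P(1)] P by simp
  then obtain i where i: "card (P \<inter> H) = p ^ i" using dvd_prime_powerD p by blast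
  have "{\<one>, z} \<subseteq> P \<inter> H" using z I subgroup.one_closed by blast
  then have "card (P \<inter> H) \<noteq> 1"
    using z(3) by (metis card_1_singletonE insert_subset singletonD)
  then have "i \<noteq> 0" using i by auto
  then have "p dvd card (P \<inter> H)" using i by simp
  moreover have "card (P \<inter> H) dvd card H" using card_subgroup_dvd[OF I H] by simp
  ultimately show ?thesis by (rule dvd_trans)
qed

lemma subgroup_nontrivial_element:
  assumes "subgroup H G" "card H \<noteq> 1"
  obtains z where "z \<in> H" "z \<noteq> \<one>"
proof (cases "\<exists>z\<in>H. z \<noteq> \<one>")
  case False
  then have "H = {\<one>}" using subgroup.one_closed[OF assms(1)] by blast
  then show ?thesis using assms(2) by simp
qed (use that in blast)

text \<open>Cauchy's theorem inside \<open>M\<close>. \<open>sylow_thm\<close> is applied with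
  exponent 1, the cofactor \<open>r\<close> being allowed to contain further factors
  \<open>p\<close>.\<close>

lemma prime_subgroup_exists:
  assumes p: "Factorial_Ring.prime p" and M: "subgroup M G" "p dvd card M" and fin: "finite (carrier G)"
  obtains T where "subgroup T G" "card T = p" "T \<subseteq> M"
proof -
  obtain r where r: "card M = p * r" using M by auto
  interpret M: group "G\<lparr>carrier := M\<rparr>" using M subgroup_imp_group by blast
  have "finite M" using M fin by (meson finite_subset subgroup.subset)
  then obtain T where T: "subgroup T (G\<lparr>carrier := M\<rparr>)" "card T = p ^ 1"
    using sylow_thm[OF p M.group_axioms, of 1 r] r by (auto simp: order_def)
  moreover have "T \<subseteq> M" using subgroup.subset[OF T(1)] by simp
  ultimately show thesis using that incl_subgroup[OF M(1) T(1)] by simp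
qed

end

text \<open>The negation of the claim, together with the arithmetic that the theorem's hypotheses
  yield; \<open>inconsistent\<close> refutes the whole. The prime \<open>q\<close> enters through
  \<open>m_less\<close>, \<open>dvd_m\<close> and \<open>m_not_prime\<close>.\<close>

locale cd_bounded = group +
  fixes m p k :: nat
  assumes fin: "finite (carrier G)"
    and order_eq: "order G = m * p ^ k"
    and prime: "Factorial_Ring.prime p"
    and k_pos: "k \<ge> 1"
    and p_less: "p < m"
    and m_less: "m < p\<^sup>2"
    and dvd_m: "d dvd m \<Longrightarrow> d < p \<or> d = m"
    and m_not_prime: "\<not> Factorial_Ring.prime m"
    and measure_le: "subgroup H G \<Longrightarrow> card H * card (centralizer G H) \<le> order G"
begin

section \<open>Sylow subgroups when no measure exceeds the group order\<close>

lemma p_gt_1: "p > 1" using prime by (rule prime_gt_1_nat)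

lemma finite_subgroup: "subgroup H G \<Longrightarrow> finite H"
  using fin by (meson finite_subset subgroup.subset)

lemma card_pos: "subgroup H G \<Longrightarrow> card H > 0"
  using fin subgroup.finite_imp_card_positive by blast

lemma card_eq_order: "subgroup H G \<Longrightarrow> card H = order G \<Longrightarrow> H = carrier G"
  using fin by (simp add: card_subset_eq order_def subgroup.subset)

text \<open>Otherwise the centre of \<open>G\<close> is nontrivial, and its measure is at least
  twice \<open>order G\<close>.\<close>

lemma centralizer_ne_carrier:
  assumes z: "z \<in> carrier G" "z \<noteq> \<one>"
  shows "centralizer G {z} \<noteq> carrier G"
proof
  assume C: "centralizer G {z} = carrier G"
  let ?H = "centralizer G (carrier G)"
  have H: "subgroup ?H G" by (rule subgroup_centralizer) simp
  have "z \<in> ?H" using subset_centralizer_centralizer[of "{z}"] z C by simp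
  then have "card ?H \<noteq> 1"
    using z subgroup.one_closed[OF H] by (metis card_1_singletonE singletonD)
  then have "card ?H \<ge> 2" using card_pos[OF H] by linarith
  moreover have "centralizer G ?H = carrier G"
    using centralizer_centralizer_centralizer[of "{z}"] z C by simp
  then have "card ?H * order G \<le> order G" using measure_le[OF H] by (simp add: order_def)
  moreover have "order G > 0" using fin by (simp add: order_gt_0_iff_finite)
  ultimately show False by simp
qed

text \<open>The double centralizer of \<open>z\<close> contains \<open>z\<close>, so its order is a
  multiple of \<open>p\<close>, and its own centralizer is that of \<open>z\<close>. Its measure
  gives the bound.\<close>

lemma p_card_centralizer_le:
  assumes P: "subgroup P G" "card P = p ^ j" and z: "z \<in> P" "z \<noteq> \<one>"
  shows "p * card (centralizer G {z}) \<le> order G"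
proof -
  have zc: "{z} \<subseteq> carrier G" using P z subgroup.subset by blast
  let ?H = "centralizer G (centralizer G {z})"
  have H: "subgroup ?H G" by (rule subgroup_centralizer) (rule centralizer_subset)
  have "z \<in> ?H" using subset_centralizer_centralizer[OF zc] by simp
  then have "p dvd card ?H" using prime_dvd_card_subgroup[OF prime P H] z by simp
  then have "p \<le> card ?H" using card_pos[OF H] by (rule dvd_imp_le)
  then have "p * card (centralizer G {z}) \<le> card ?H * card (centralizer G ?H)"
    using centralizer_centralizer_centralizer[OF zc] by simp
  also have "\<dots> \<le> order G" using measure_le[OF H] .
  finally show ?thesis .
qed

text \<open>If \<open>P\<close> is normal, so is its centre \<open>?Z\<close>. The measure of
  \<open>?Z\<close> gives \<open>card ?Z \<le> m\<close>, below the square of \<open>p\<close>, so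
  the order is \<open>p\<close>. Then a nontrivial \<open>z\<close> in \<open>?Z\<close> has at most
  \<open>p - 1\<close> conjugates, while \<open>p_card_centralizer_le\<close> demands at least
  \<open>p\<close>.\<close>

lemma sylow_not_normal:
  assumes P: "subgroup P G" "card P = p ^ k"
  shows "set_normalizer P \<noteq> carrier G"
proof
  assume N: "set_normalizer P = carrier G"
  have Pc: "P \<subseteq> carrier G" and finP: "finite P"
    using P subgroup.subset finite_subgroup by blast+
  let ?Z = "P \<inter> centralizer G P"
  have Z: "subgroup ?Z G" using P subgroup_centralizer[OF Pc] subgroups_Inter_pair by blast
  have "p dvd card P" using P k_pos by simp
  then have pZ: "p dvd card ?Z"
    using prime_dvd_card_fixed_points[OF prime P Pc _ _ fin] N Pc by simp
  have NZ: "set_normalizer ?Z = carrier G"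
    using N set_normalizer_centralizer[OF finP Pc] set_normalizer_Int[of P "centralizer G P"] set_normalizer_subset[of ?Z]
      set_normalizer_subset[of "centralizer G P"] by blast
  have Zc: "?Z \<subseteq> carrier G" using Pc by blast
  have "P \<subseteq> centralizer G ?Z" using Pc by (auto simp: centralizer_def)
  then have "card P \<le> card (centralizer G ?Z)"
    using finite_subgroup[OF subgroup_centralizer[OF Zc]] by (simp add: card_mono)
  then have "card ?Z * p ^ k \<le> m * p ^ k"
    using measure_le[OF Z] P order_eq by (metis le_trans mult_le_mono2)
  then have "card ?Z \<le> m" using p_gt_1 by simp
  then have lt: "card ?Z < p ^ 2" using m_less by simp
  have "card ?Z dvd p ^ k" using card_subgroup_dvd[OF Z P(1)] P by simp
  then obtain i where i: "card ?Z = p ^ i" using dvd_prime_powerD prime by blast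
  then have "i < 2" using lt p_gt_1 by simp
  moreover have "i \<noteq> 0" using i pZ p_gt_1 by (metis nat_dvd_1_iff_1 power_0 less_irrefl)
  ultimately have "i = 1" by simp
  then have cZ: "card ?Z = p" using i by simp
  then obtain z where z: "z \<in> ?Z" "z \<noteq> \<one>"
    using subgroup_nontrivial_element[OF Z] p_gt_1 by (metis less_irrefl)
  have zc: "z \<in> carrier G" using z Pc by blast
  let ?O = "(\<lambda>g. conjugate g z) ` carrier G"
  have "?O \<subseteq> ?Z - {\<one>}"
  proof (rule image_subsetI)
    fix g assume g: "g \<in> carrier G"
    then have "g \<in> set_normalizer ?Z" using NZ by simp
    then have "conjugate g z \<in> ?Z" using z by (simp add: set_normalizer_def)
    moreover have "conjugate g z \<noteq> \<one>" using conjugate_eq_one_iff[OF g zc] z by simp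
    ultimately show "conjugate g z \<in> ?Z - {\<one>}" by simp
  qed
  then have "card ?O \<le> card (?Z - {\<one>})" using finP by (intro card_mono) auto
  also have "\<dots> = p - 1" using cZ subgroup.one_closed[OF Z] finP by simp
  finally have O: "card ?O \<le> p - 1" .
  let ?c = "card (centralizer G {z})"
  have "carrier G \<inter> centralizer G {z} = centralizer G {z}" using centralizer_subset by blast
  then have "card ?O * ?c = order G"
    using card_conj_class[OF subgroup_self zc fin] by (simp add: order_def)
  then have "p * ?c \<le> (p - 1) * ?c"
    using p_card_centralizer_le[OF P] z O by (metis IntD1 le_trans mult_le_mono1)
  moreover have "?c > 0" using card_pos[OF subgroup_centralizer] zc by simp
  ultimately have "p \<le> p - 1" by (metis mult_le_cancel2)
  then show False using p_gt_1 by linarith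
qed

text \<open>Let \<open>t\<close> be the index of \<open>P\<close> in \<open>M\<close>, a divisor of
  \<open>m\<close>. If \<open>Q\<close> lies in \<open>M\<close>, counting \<open>P <#> Q\<close>
  inside \<open>M\<close> gives \<open>p \<le> t\<close>; otherwise counting \<open>M <#> Q\<close>
  inside \<open>G\<close> gives \<open>t * p \<le> m\<close>. By \<open>dvd_m\<close> a divisor of
  \<open>m\<close> that is at least \<open>p\<close> equals \<open>m\<close>, so
  \<open>t = m\<close> or \<open>t = 1\<close>.\<close>

lemma sylow_maximal:
  assumes P: "subgroup P G" "card P = p ^ k" and Q: "subgroup Q G" "card Q = p ^ k"
    and PQ: "P \<noteq> Q" and M: "subgroup M G" "P \<subseteq> M"
  shows "M = P \<or> M = carrier G"
proof -
  have pk: "p ^ k > 0" using p_gt_1 by simp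
  have finP: "finite P" "finite Q" "finite M" using P Q M finite_subgroup by blast+
  obtain t where t: "card M = p ^ k * t" using card_subgroup_dvd[OF P(1) M] P by (auto elim: dvdE)
  have "card M dvd order G"
    using card_subgroup_dvd[OF M(1) subgroup_self subgroup.subset[OF M(1)]] by (simp add: order_def)
  then have tm: "t dvd m"
    using t order_eq pk by (metis dvd_times_right_cancel_iff mult.commute not_gr_zero)
  have small: "card H * p \<le> p ^ k" if "subgroup H G" "H \<subset> Q" for H
  proof -
    have "card H dvd p ^ k" using card_subgroup_dvd[OF that(1) Q(1)] that Q by auto
    moreover have "card H < p ^ k" using psubset_card_mono[OF finP(2) that(2)] Q by simp
    ultimately show ?thesis using proper_dvd_prime_power[OF prime] by auto
  qed
  have notQP: "\<not> Q \<subseteq> P" using card_subset_eq[OF finP(1)] P Q PQ by auto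
  show ?thesis
  proof (cases "Q \<subseteq> M")
    case True
    have "P \<inter> Q \<subset> Q" using notQP by blast
    then have s: "card (P \<inter> Q) * p \<le> p ^ k" using small subgroups_Inter_pair P Q by blast
    have "p ^ k * p ^ k \<le> p ^ k * t * card (P \<inter> Q)"
      using card_mult_le_Int[OF P(1) Q(1) M(1) M(2) True fin] P Q t by simp
    then have "p ^ k * p ^ k * p \<le> p ^ k * t * card (P \<inter> Q) * p" by (rule mult_le_mono1)
    also have "\<dots> \<le> p ^ k * t * p ^ k" using s by (simp add: mult.assoc)
    finally have "p \<le> t" using pk p_gt_1 by simp
    then have "t = m" using dvd_m[OF tm] by simp
    then show ?thesis using card_eq_order[OF M(1)] t order_eq by (simp add: mult.commute)
  next
    case False
    then have "M \<inter> Q \<subset> Q" by blast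
    then have s: "card (M \<inter> Q) * p \<le> p ^ k" using small subgroups_Inter_pair M Q by blast
    have "p ^ k * t * p ^ k \<le> m * p ^ k * card (M \<inter> Q)"
      using card_mult_le_Int[OF M(1) Q(1) subgroup_self _ _ fin] M Q t order_eq
      by (simp add: subgroup.subset order_def)
    then have "p ^ k * t * p ^ k * p \<le> m * p ^ k * card (M \<inter> Q) * p" by (rule mult_le_mono1)
    also have "\<dots> \<le> m * p ^ k * p ^ k" using s by (simp add: mult.assoc)
    finally have tp: "t * p \<le> m" using pk p_gt_1 by simp
    obtain s where s: "m = t * s" using tm by auto
    have "t > 0" using s p_less by (cases t) auto
    then have "p \<le> s" using tp s by simp
    then have "s = m" using dvd_m[of s] s by simp
    moreover have "m > 0" using p_less by simp
    ultimately have "t = 1" using s by (metis mult_cancel2 mult_1 not_gr_zero)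
    then have "M = P" using card_subset_eq[OF finP(3) M(2)] P t by simp
    then show ?thesis by simp
  qed
qed

lemma sylow_self_normalizing:
  assumes P: "subgroup P G" "card P = p ^ k" and Q: "subgroup Q G" "card Q = p ^ k" and PQ: "P \<noteq> Q"
  shows "set_normalizer P = P"
proof -
  have Pc: "P \<subseteq> carrier G" using P subgroup.subset by blast
  show ?thesis
    using sylow_maximal[OF P Q PQ subgroup_set_normalizer[OF finite_subgroup[OF P(1)] Pc] subgroup_subset_set_normalizer[OF P(1)]]
      sylow_not_normal[OF P] by blast
qed

lemma centralizer_eq_sylow:
  assumes P: "subgroup P G" "card P = p ^ k" and Q: "subgroup Q G" "card Q = p ^ k" and PQ: "P \<noteq> Q"
    and l: "l \<in> carrier G" "l \<noteq> \<one>" and cent: "l \<in> centralizer G P"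
  shows "centralizer G {l} = P"
proof -
  have Pc: "P \<subseteq> carrier G" using P subgroup.subset by blast
  have "P \<subseteq> centralizer G {l}" using cent Pc by (auto simp: centralizer_def)
  moreover have "subgroup (centralizer G {l}) G" using l subgroup_centralizer by simp
  ultimately show ?thesis
    using sylow_maximal[OF P Q PQ] centralizer_ne_carrier[OF l] by blast
qed

text \<open>Counting \<open>P <#> Q\<close> inside \<open>G\<close> and \<open>m_less\<close> leave
  only index \<open>p\<close> for the intersection. It is then normalized by both \<open>P\<close>
  and \<open>Q\<close>, and its normalizer is all of \<open>G\<close> by maximality of
  \<open>P\<close>.\<close>

lemma sylow_Int:
  assumes P: "subgroup P G" "card P = p ^ k" and Q: "subgroup Q G" "card Q = p ^ k" and PQ: "P \<noteq> Q"
  shows "card (P \<inter> Q) = p ^ (k - 1)" "set_normalizer (P \<inter> Q) = carrier G"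
proof -
  have pk: "p ^ k > 0" using p_gt_1 by simp
  have finP: "finite P" "finite Q" using P Q finite_subgroup by blast+
  have sub: "P \<subseteq> carrier G" "Q \<subseteq> carrier G" using P Q subgroup.subset by blast+
  have D: "subgroup (P \<inter> Q) G" using P Q subgroups_Inter_pair by blast
  have notsub: "\<not> Q \<subseteq> P" using card_subset_eq[OF finP(1)] P Q PQ by auto
  then have "P \<inter> Q \<subset> Q" by blast
  then have lt: "card (P \<inter> Q) < p ^ k" using psubset_card_mono[OF finP(2)] Q by simp
  have "card (P \<inter> Q) dvd p ^ k" using card_subgroup_dvd[OF D P(1)] P by simp
  then obtain i where i: "card (P \<inter> Q) = p ^ i" using dvd_prime_powerD prime by blast
  then have "i < k" using lt p_gt_1 by simp
  have "p ^ k * p ^ k \<le> m * p ^ k * p ^ i"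
    using card_mult_le_Int[OF P(1) Q(1) subgroup_self sub fin] P Q i order_eq by (simp add: order_def)
  also have "\<dots> < p ^ 2 * p ^ k * p ^ i" using m_less p_gt_1 by simp
  finally have "p ^ k < p ^ 2 * p ^ i" using pk by simp
  then have "p ^ k < p ^ (2 + i)" by (simp only: power_add)
  then have "k < 2 + i" using p_gt_1 by (metis power_less_imp_less_exp)
  with \<open>i < k\<close> have ik: "k = Suc i" by simp
  then show "card (P \<inter> Q) = p ^ (k - 1)" using i by simp
  have "P \<subseteq> set_normalizer (P \<inter> Q)" "Q \<subseteq> set_normalizer (P \<inter> Q)"
    using index_prime_subset_set_normalizer[OF prime _ _ D i _ fin] P Q ik by auto
  moreover have "subgroup (set_normalizer (P \<inter> Q)) G"
    using subgroup_set_normalizer finP sub by blast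
  ultimately show "set_normalizer (P \<inter> Q) = carrier G"
    using sylow_maximal[OF P Q PQ] notsub by blast
qed

section \<open>Contradiction from two distinct Sylow subgroups\<close>

text \<open>The elements lying in no conjugate of \<open>P\<close>, together with the identity, turn out to form an
  abelian subgroup of order \<open>m\<close>, whose measure \<open>m\<^sup>2\<close> is too large.\<close>

lemma no_two_sylow_of_prime_order:
  assumes k: "k = 1" and P: "subgroup P G" "card P = p ^ k" and Q: "subgroup Q G" "card Q = p ^ k"
    and PQ: "P \<noteq> Q"
  shows False
proof -
  have cP: "card P = p" using P k by simp
  have ord: "order G = m * p" using order_eq k by simp
  have Pc: "P \<subseteq> carrier G" and finP: "finite P"
    using P subgroup.subset finite_subgroup by blast+
  have NP: "set_normalizer P = P" using sylow_self_normalizing[OF P Q PQ] .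
  have I: "subgroup (P \<inter> centralizer G P) G"
    using P subgroup_centralizer[OF Pc] subgroups_Inter_pair by blast
  \<comment> \<open>The fixed points of \<open>P\<close> acting on itself form its centre; as
    \<open>P\<close> has order \<open>p\<close>, divisibility makes \<open>P\<close>
    abelian.\<close>
  have "p dvd card (P \<inter> centralizer G P)"
    using prime_dvd_card_fixed_points[OF prime P Pc _ _ fin] NP cP by simp
  then have "card P \<le> card (P \<inter> centralizer G P)"
    using card_pos[OF I] cP by (simp add: dvd_imp_le)
  then have "P \<inter> centralizer G P = P" using card_seteq[OF finP] by blast
  then have PC: "P \<subseteq> centralizer G P" by blast
  let ?L = "P - {\<one>}"
  \<comment> \<open>\<open>S\<close> is the set of nonidentity elements of all conjugates of
    \<open>P\<close>. It has \<open>m * (p - 1)\<close> elements, which leaves exactly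
    \<open>m\<close> for the complement \<open>K\<close>.\<close>
  define S where "S = (\<lambda>(g, l). conjugate g l) ` (carrier G \<times> ?L)"
  have Lc: "?L \<subseteq> carrier G" using Pc by blast
  have CL: "centralizer G {l} = P" if "l \<in> ?L" for l
    using centralizer_eq_sylow[OF P Q PQ] that Pc PC by blast
  have "card ?L = p - 1" using cP finP subgroup.one_closed[OF P(1)] by simp
  then have "card S * p = m * p * (p - 1)"
    using card_conjugates[OF P(1) NP fin Lc CL] cP ord by (simp add: S_def)
  then have cS: "card S = m * (p - 1)" using p_gt_1 by simp
  have Sc: "S \<subseteq> carrier G" using Lc by (auto simp: S_def)
  define K where "K = carrier G - S"
  have finS: "finite S" "finite K" using Sc fin finite_subset by (auto simp: K_def)
  have "card K = m * p - m * (p - 1)"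
    using card_Diff_subset[OF finS(1) Sc] cS ord by (simp add: order_def K_def)
  also have "\<dots> = m" using p_gt_1 by (simp add: diff_mult_distrib2[symmetric])
  finally have cK: "card K = m" .
  have "\<one> \<notin> S"
  proof
    assume "\<one> \<in> S"
    then obtain g l where "g \<in> carrier G" "l \<in> ?L" "conjugate g l = \<one>" unfolding S_def by force
    then show False using conjugate_eq_one_iff Lc by blast
  qed
  then have oneK: "\<one> \<in> K" by (simp add: K_def)
  have conjS: "x \<in> S" if "conjugate h x \<in> S" "h \<in> carrier G" "x \<in> carrier G" for h x
  proof -
    obtain g l where gl: "g \<in> carrier G" "l \<in> ?L" "conjugate h x = conjugate g l"
      using \<open>conjugate h x \<in> S\<close> unfolding S_def by force
    have "x = conjugate (inv h) (conjugate h x)" using that by simp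
    also have "\<dots> = conjugate (inv h \<otimes> g) l"
      using gl that Lc by (simp add: conjugate_conjugate subset_eq)
    finally show ?thesis
      using gl that unfolding S_def by (intro image_eqI[where x = "(inv h \<otimes> g, l)"]) auto
  qed
  have main: "centralizer G {x} = K" if x: "x \<in> K" "x \<noteq> \<one>" for x
  proof -
    let ?C = "centralizer G {x}"
    let ?O = "(\<lambda>g. conjugate g x) ` carrier G"
    have xc: "x \<in> carrier G" using x by (simp add: K_def)
    have C: "subgroup ?C G" using subgroup_centralizer xc by simp
    have xC: "x \<in> ?C" using xc by (simp add: centralizer_def)
    \<comment> \<open>\<open>K\<close> is closed under conjugation, so \<open>x\<close> has at most
      \<open>m - 1\<close> conjugates among the \<open>m * p\<close> elements of \<open>G\<close>;
      this forces \<open>p < card ?C\<close>.\<close>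
    have "?O \<subseteq> K - {\<one>}"
    proof (rule image_subsetI)
      fix g assume g: "g \<in> carrier G"
      then have "conjugate g x \<notin> S" using conjS[OF _ g xc] x by (auto simp: K_def)
      then show "conjugate g x \<in> K - {\<one>}"
        using g xc x conjugate_eq_one_iff by (simp add: K_def)
    qed
    then have "card ?O \<le> card (K - {\<one>})" using finS by (intro card_mono) auto
    then have "card ?O \<le> m - 1" using cK oneK finS by simp
    moreover have "carrier G \<inter> ?C = ?C" using centralizer_subset by blast
    then have OC: "card ?O * card ?C = m * p"
      using card_conj_class[OF subgroup_self xc fin] ord by (simp add: order_def)
    ultimately have "m * p \<le> (m - 1) * card ?C" by (metis mult_le_mono1)
    have gt: "p < card ?C"
    proof (rule ccontr)
      assume "\<not> p < card ?C"
      then have "(m - 1) * card ?C \<le> (m - 1) * p" by simp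
      then have "m * p \<le> (m - 1) * p" using \<open>m * p \<le> (m - 1) * card ?C\<close> by linarith
      then have "m \<le> m - 1"
        using p_gt_1 by (metis mult_le_cancel2 not_less_iff_gr_or_eq less_trans zero_less_one)
      then show False using p_less by linarith
    qed
    \<comment> \<open>A subgroup \<open>T\<close> of order \<open>p\<close> in \<open>?C\<close>
      would be a Sylow subgroup, hence maximal, so \<open>?C\<close> would be \<open>T\<close>,
      which is too small, or \<open>G\<close>. Since \<open>sylow_maximal\<close> asks for a second
      Sylow subgroup, \<open>R\<close> is whichever of \<open>P\<close> and \<open>Q\<close> differs
      from \<open>T\<close>.\<close>
    have ndvd: "\<not> p dvd card ?C"
    proof
      assume "p dvd card ?C"
      then obtain T where T: "subgroup T G" "card T = p" "T \<subseteq> ?C"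
        using prime_subgroup_exists[OF prime C _ fin] by blast
      have Tk: "card T = p ^ k" using T k by simp
      obtain R where R: "subgroup R G" "card R = p ^ k" "T \<noteq> R" using P Q PQ by metis
      have "?C = T \<or> ?C = carrier G" using sylow_maximal[OF T(1) Tk R C T(3)] .
      then show False using centralizer_ne_carrier[OF xc x(2)] gt T by auto
    qed
    then have "coprime (card ?C) p" using prime by (metis coprime_commute prime_imp_coprime)
    moreover have "card ?C dvd m * p" using OC by (metis dvd_triv_right)
    ultimately have "card ?C dvd m" by (simp add: coprime_dvd_mult_left_iff)
    then have cC: "card ?C = m" using dvd_m[of "card ?C"] gt by auto
    \<comment> \<open>An element of \<open>S\<close> in \<open>?C\<close> lies in a conjugate of
      \<open>P\<close>, a group of order \<open>p\<close>, and would make \<open>p\<close> divide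
      \<open>card ?C\<close>.\<close>
    have "?C \<subseteq> K"
    proof
      fix y assume y: "y \<in> ?C"
      then have yc: "y \<in> carrier G" using centralizer_subset by blast
      have "y \<notin> S"
      proof
        assume "y \<in> S"
        then obtain g l where gl: "g \<in> carrier G" "l \<in> ?L" "y = conjugate g l" unfolding S_def by force
        have c: "card (conjugate g ` P) = p ^ 1" using card_conjugate_image[OF gl(1) Pc] cP by simp
        have "l \<in> carrier G" "l \<noteq> \<one>" using gl(2) Lc by auto
        then have y1: "y \<noteq> \<one>" using gl conjugate_eq_one_iff by simp
        have "y \<in> conjugate g ` P" using gl by simp
        then show False
          using prime_dvd_card_subgroup[OF prime subgroup_conjugate_image[OF P(1) gl(1)] c C _ y y1] ndvd by simp
      qed
      then show "y \<in> K" using yc by (simp add: K_def)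
    qed
    then show ?thesis using card_subset_eq[OF finS(2)] cC cK by simp
  qed
  have "K \<noteq> {\<one>}"
    using cK p_less p_gt_1 by (metis is_singletonI is_singleton_altdef less_asym)
  then obtain x where x: "x \<in> K" "x \<noteq> \<one>" using oneK by blast
  \<comment> \<open>\<open>K\<close> is a subgroup because it is a centralizer, and it is abelian
    because it centralizes each of its nonidentity elements.\<close>
  have "subgroup K G" using subgroup_centralizer[of "{x}"] main[OF x] x by (simp add: K_def)
  moreover have "K \<subseteq> centralizer G K"
  proof
    fix y assume y: "y \<in> K"
    then have yc: "y \<in> carrier G" by (simp add: K_def)
    have "y \<otimes> h = h \<otimes> y" if h: "h \<in> K" for h
    proof (cases "h = \<one>")
      case False
      then have "y \<in> centralizer G {h}" using main[OF h] y by simp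
      then show ?thesis by (simp add: centralizer_def)
    qed (use yc in simp)
    then show "y \<in> centralizer G K" using yc by (simp add: centralizer_def)
  qed
  then have "m \<le> card (centralizer G K)"
    using cK card_mono finite_subset[OF centralizer_subset fin] by metis
  ultimately have "m * m \<le> m * p"
    using measure_le[of K] cK ord by (metis le_trans mult_le_mono2)
  then show False using p_less by simp
qed

text \<open>Here the centre \<open>V\<close> of \<open>P \<inter> Q\<close> has order \<open>p\<^sup>2\<close>, and the fixed points of the \<open>m\<close> conjugates of \<open>P\<close>
  on \<open>V\<close> are distinct lines. So \<open>m = p + 1\<close> and these are all the lines of \<open>V\<close>; an involution then has
  no fixed point on \<open>V\<close>, inverts it, and normalizes \<open>P\<close>.\<close>

lemma no_two_sylow_of_large_order:
  assumes k: "k \<ge> 2" and P: "subgroup P G" "card P = p ^ k" and Q: "subgroup Q G" "card Q = p ^ k"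
    and PQ: "P \<noteq> Q"
  shows False
proof -
  have Pc: "P \<subseteq> carrier G" and finP: "finite P"
    using P subgroup.subset finite_subgroup by blast+
  have NP: "set_normalizer P = P" using sylow_self_normalizing[OF P Q PQ] .
  have PnG: "P \<noteq> carrier G" using sylow_not_normal[OF P] NP by simp
  define D where "D = P \<inter> Q"
  have cD: "card D = p ^ (k - 1)" and ND: "set_normalizer D = carrier G"
    using sylow_Int[OF P Q PQ] by (auto simp: D_def)
  have sD: "subgroup D G" using P Q subgroups_Inter_pair unfolding D_def by blast
  have Dc: "D \<subseteq> carrier G" and finD: "finite D" using Pc finP by (auto simp: D_def)
  have "p dvd card D" using cD k by (simp add: numeral_2_eq_2)
  define V where "V = D \<inter> centralizer G D"
  have VD: "V \<subseteq> D" "V \<subseteq> centralizer G D" by (auto simp: V_def)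
  have sV: "subgroup V G" unfolding V_def
    using sD subgroup_centralizer[OF Dc] by (rule subgroups_Inter_pair)
  have Vc: "V \<subseteq> carrier G" and finV: "finite V" using VD Dc finD finite_subset by auto
  have pV: "p dvd card V"
    using prime_dvd_card_fixed_points[OF prime sD cD Dc _ \<open>p dvd card D\<close> fin] ND Dc by (simp add: V_def)
  have NV: "set_normalizer V = carrier G"
  proof -
    have "set_normalizer D \<inter> set_normalizer (centralizer G D) \<subseteq> set_normalizer V" unfolding V_def by (rule set_normalizer_Int)
    then show ?thesis
      using ND set_normalizer_centralizer[OF finD Dc] set_normalizer_subset[of V] by blast
  qed
  have CV: "subgroup (centralizer G V) G" using subgroup_centralizer[OF Vc] .
  \<comment> \<open>\<open>V\<close> is centralized by \<open>D\<close>, so the bound on its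
    measure, with \<open>m_less\<close>, leaves \<open>card V\<close> below the cube of
    \<open>p\<close>.\<close>
  have "D \<subseteq> centralizer G V" using Dc by (auto simp: centralizer_def V_def)
  then have "card D \<le> card (centralizer G V)" using finite_subgroup[OF CV] by (simp add: card_mono)
  then have "card V * card D \<le> card V * card (centralizer G V)" by (rule mult_le_mono2)
  also have "\<dots> \<le> order G" by (rule measure_le[OF sV])
  finally have "card V * p ^ (k - 1) \<le> m * p ^ k" unfolding cD order_eq .
  also have "\<dots> < p ^ 2 * p ^ k" using m_less p_gt_1 by simp
  also have "\<dots> = p ^ 3 * p ^ (k - 1)" unfolding power_add[symmetric] using k by simp
  finally have V3: "card V < p ^ 3" by simp
  have "card V dvd p ^ (k - 1)" using card_subgroup_dvd[OF sV sD VD(1)] cD by simp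
  then obtain b where b: "card V = p ^ b" using dvd_prime_powerD prime by blast
  then have b3: "b < 3" using V3 p_gt_1 by simp
  define L where "L = V \<inter> centralizer G P"
  have LV: "L \<subseteq> V" "L \<subseteq> centralizer G P" by (auto simp: L_def)
  have sL: "subgroup L G" unfolding L_def
    using sV subgroup_centralizer[OF Pc] by (rule subgroups_Inter_pair)
  have pL: "p dvd card L"
    using prime_dvd_card_fixed_points[OF prime P Vc _ pV fin] NV Pc by (simp add: L_def)
  then have "p \<le> card L" using card_pos[OF sL] by (rule dvd_imp_le)
  \<comment> \<open>If \<open>P\<close> centralized \<open>V\<close>, maximality would make
    \<open>centralizer G V\<close> equal to \<open>P\<close> or \<open>G\<close>. In the first case
    \<open>P\<close> is normal because \<open>V\<close> is; in the second \<open>V\<close> is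
    central.\<close>
  have "L \<noteq> V"
  proof
    assume "L = V"
    then have "P \<subseteq> centralizer G V" using Pc LV by (auto simp: centralizer_def)
    then have "centralizer G V = P \<or> centralizer G V = carrier G"
      using sylow_maximal[OF P Q PQ CV] by blast
    then show False
    proof
      assume "centralizer G V = P"
      then have "carrier G \<subseteq> set_normalizer P"
        using set_normalizer_centralizer[OF finV Vc] NV by simp
      then show False using PnG NP Pc by blast
    next
      assume C: "centralizer G V = carrier G"
      have "card V \<noteq> 1" using pV p_gt_1 by auto
      then obtain z where z: "z \<in> V" "z \<noteq> \<one>"
        using subgroup_nontrivial_element[OF sV] by blast
      have "centralizer G V \<subseteq> centralizer G {z}" using z by (intro centralizer_antimono) simp
      then show False using C centralizer_ne_carrier[of z] z Vc centralizer_subset by blast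
    qed
  qed
  moreover have "card L dvd p ^ b" using card_subgroup_dvd[OF sL sV LV(1)] b by simp
  \<comment> \<open>From \<open>p \<le> card L\<close>, this bound and \<open>b < 3\<close>, the
    orders of \<open>L\<close> and \<open>V\<close> must be \<open>p\<close> and
    \<open>p * p\<close>.\<close>
  ultimately have Lp: "card L * p \<le> p ^ b"
    using proper_dvd_prime_power[OF prime] card_subset_eq[OF finV LV(1)] b by metis
  have "p ^ b \<le> p ^ 2" using b3 p_gt_1 by (intro power_increasing) auto
  have "card L \<le> p"
  proof -
    have "card L * p \<le> p * p"
      using Lp \<open>p ^ b \<le> p ^ 2\<close> unfolding power2_eq_square by linarith
    then show ?thesis using p_gt_1 by simp
  qed
  then have cL: "card L = p" using \<open>p \<le> card L\<close> by simp
  then have cV: "card V = p * p"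
    using Lp \<open>p ^ b \<le> p ^ 2\<close> b by (simp add: power2_eq_square)
  \<comment> \<open>The conjugates of the nonidentity elements of \<open>L\<close> number
    \<open>m * (p - 1)\<close> and lie among the \<open>(p + 1) * (p - 1)\<close> nonidentity
    elements of the normal subgroup \<open>V\<close>. Hence \<open>m = p + 1\<close>, and
    \<open>S\<close> fills \<open>V - {\<one>}\<close>.\<close>
  define S where "S = (\<lambda>(g, l). conjugate g l) ` (carrier G \<times> (L - {\<one>}))"
  have L'c: "L - {\<one>} \<subseteq> carrier G" using LV Vc by blast
  have CL: "centralizer G {l} = P" if "l \<in> L - {\<one>}" for l
    using centralizer_eq_sylow[OF P Q PQ] that L'c LV by blast
  have "card (L - {\<one>}) = p - 1" using cL finite_subgroup[OF sL] subgroup.one_closed[OF sL] by simp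
  then have "card S * p ^ k = m * p ^ k * (p - 1)"
    using card_conjugates[OF P(1) NP fin L'c CL] P order_eq by (simp add: S_def)
  then have cS: "card S = m * (p - 1)" using p_gt_1 by simp
  have SV: "S \<subseteq> V - {\<one>}"
  proof
    fix s assume "s \<in> S"
    then obtain g l where gl: "g \<in> carrier G" "l \<in> L - {\<one>}" "s = conjugate g l" unfolding S_def by force
    have "g \<in> set_normalizer V" using gl NV by simp
    then have "s \<in> V" using gl LV by (auto simp: set_normalizer_def)
    moreover have "l \<in> carrier G" "l \<noteq> \<one>" using gl(2) L'c by auto
    then have "s \<noteq> \<one>" using gl conjugate_eq_one_iff by simp
    ultimately show "s \<in> V - {\<one>}" by blast
  qed
  have cV': "card (V - {\<one>}) = (p + 1) * (p - 1)"
    using cV finV subgroup.one_closed[OF sV] by (simp add: algebra_simps)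
  have "m * (p - 1) \<le> (p + 1) * (p - 1)" using card_mono[OF _ SV] finV cS cV' by simp
  then have "m \<le> p + 1" using p_gt_1 by (metis mult_le_cancel2 zero_less_diff)
  then have m: "m = p + 1" using p_less by simp
  then have S: "S = V - {\<one>}" using card_subset_eq[OF _ SV] finV cS cV' by simp
  \<comment> \<open>For \<open>p = 2\<close> one would have \<open>m = 3\<close>, a prime. With
    \<open>p\<close> odd, \<open>m = p + 1\<close> is even, so \<open>G\<close> contains an
    involution.\<close>
  have "p \<noteq> 2" using m m_not_prime by auto
  then have "odd p" using prime_odd_nat[OF prime] p_gt_1 by simp
  then have not2: "\<not> 2 dvd p ^ k" by simp
  have "2 dvd card (carrier G)" using m order_eq \<open>odd p\<close> by (simp add: order_def)
  then obtain T where T: "subgroup T G" "card T = 2"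
    using prime_subgroup_exists[OF two_is_prime_nat subgroup_self _ fin] by blast
  obtain t where t: "t \<in> T" "t \<noteq> \<one>"
    using subgroup_nontrivial_element[OF T(1)] T(2) by auto
  have tc: "t \<in> carrier G" using t T subgroup.subset by blast
  have no_t: "t \<notin> H" if "subgroup H G" "card H = p ^ k" for H
    using prime_dvd_card_subgroup[OF two_is_prime_nat T(1) _ that(1) t(1) _ t(2), of 1] T that not2 by auto
  have tt: "t \<otimes> t = \<one>"
  proof -
    have "T = {\<one>, t}"
      using T t subgroup.one_closed[OF T(1)] finite_subgroup[OF T(1)]
      by (intro card_subset_eq[symmetric]) auto
    then have "t \<otimes> t = \<one> \<or> t \<otimes> t = t"
      using subgroup.m_closed[OF T(1) t(1) t(1)] by blast
    then show ?thesis using t tc by (metis l_cancel_one)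
  qed
  \<comment> \<open>\<open>V\<close> is abelian and \<open>t\<close> is an involution, so
    \<open>t\<close> fixes the product of \<open>v\<close> and its conjugate. If this product were
    nontrivial, it would lie in \<open>S\<close>, and \<open>t\<close> would belong to its
    centralizer, a conjugate of \<open>P\<close>, which has odd order.\<close>
  have inverts: "conjugate t v = inv v" if v: "v \<in> V" for v
  proof -
    have vc: "v \<in> carrier G" using v Vc by blast
    have "t \<in> set_normalizer V" using NV tc by simp
    then have tv: "conjugate t v \<in> V" using v by (simp add: set_normalizer_def)
    then have tvc: "conjugate t v \<in> carrier G" using Vc by blast
    have comm: "v \<otimes> conjugate t v = conjugate t v \<otimes> v"
      using v tv VD by (auto simp: centralizer_def)
    let ?w = "v \<otimes> conjugate t v"
    have w: "?w \<in> V" using subgroup.m_closed[OF sV v tv] .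
    have "conjugate t ?w = ?w" using tc vc tvc tt comm by (simp add: conjugate_mult conjugate_conjugate)
    then have tw: "t \<in> centralizer G {?w}" using tc vc tvc by (simp add: centralizer_iff_conjugate)
    have "?w = \<one>"
    proof (rule ccontr)
      assume "?w \<noteq> \<one>"
      then have "?w \<in> S" using w S by blast
      then obtain g l where gl: "g \<in> carrier G" "l \<in> L - {\<one>}" "?w = conjugate g l" unfolding S_def by force
      have "{l} \<subseteq> carrier G" using gl L'c by blast
      then have "centralizer G {?w} = conjugate g ` P"
        using conjugate_centralizer[of "{l}" g] gl CL by simp
      then show False
        using tw no_t[OF subgroup_conjugate_image[OF P(1) gl(1)]] card_conjugate_image[OF gl(1) Pc] P by simp
    qed
    then have "conjugate t v \<otimes> v = \<one>" using comm by simp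
    then show ?thesis using inv_equality tvc vc by metis
  qed
  have "card L \<noteq> 1" using cL p_gt_1 by simp
  then obtain z where z: "z \<in> L" "z \<noteq> \<one>"
    using subgroup_nontrivial_element[OF sL] by blast
  have zc: "z \<in> carrier G" using z LV Vc by blast
  have "inv z \<in> L - {\<one>}"
    using subgroup.m_inv_closed[OF sL z(1)] z zc by (simp add: inv_eq_1_iff)
  \<comment> \<open>\<open>z\<close> and \<open>inv z\<close> both have centralizer
    \<open>P\<close>, and \<open>t\<close> conjugates one to the other.\<close>
  then have "conjugate t ` P = P"
    using conjugate_centralizer[of "{z}" t] CL[of z] CL[of "inv z"] inverts[of z] z LV zc tc by auto
  then have "t \<in> set_normalizer P" using tc by (auto simp: set_normalizer_def)
  then show False using NP no_t[OF P] by simp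
qed

text \<open>A Sylow subgroup that is not normal has a conjugate different from it, and the two cases
  \<open>k = 1\<close> and \<open>k \<ge> 2\<close> exclude such a pair.\<close>

lemma inconsistent: False
proof -
  obtain P where P: "subgroup P G" "card P = p ^ k"
    using sylow_thm[OF prime group_axioms, of k m] order_eq fin by (auto simp: mult.commute)
  have Pc: "P \<subseteq> carrier G" and finP: "finite P"
    using P subgroup.subset finite_subgroup by blast+
  have "\<not> carrier G \<subseteq> set_normalizer P"
    using sylow_not_normal[OF P] set_normalizer_subset by blast
  then obtain g where g: "g \<in> carrier G" "g \<notin> set_normalizer P" by blast
  then have "P \<noteq> conjugate g ` P" by (auto simp: set_normalizer_def)
  moreover have "subgroup (conjugate g ` P) G" "card (conjugate g ` P) = p ^ k"
    using subgroup_conjugate_image[OF P(1) g(1)] card_conjugate_image[OF g(1) Pc] P by auto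
  ultimately show False
    using no_two_sylow_of_prime_order no_two_sylow_of_large_order P k_pos
    by (metis One_nat_def Suc_leI le_neq_implies_less numeral_2_eq_2)
qed

end

section \<open>From the hypotheses on \<open>m\<close>, \<open>p\<close> and \<open>q\<close> to the
  measure\<close>

theorem theorem2:
  fixes G :: "('a, 'b) monoid_scheme" and m p k q :: nat
  assumes "group G" and "finite (carrier G)"
    and "order G = m * p ^ k"
    and "Factorial_Ring.prime p" and "k \<ge> 1"
    and "Factorial_Ring.prime q" and "q dvd m" and "\<forall>r. Factorial_Ring.prime r \<and> r dvd m \<longrightarrow> q \<le> r"
    and "1 < real m / real q" and "real m / real q < real p" and "p < m"
  shows "cd_max G > order G \<and> \<not> CD_simple G"
proof -
  interpret group G by fact
  have q: "q > 1" using \<open>Factorial_Ring.prime q\<close> by (rule prime_gt_1_nat)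
  have "real q < real m" using assms(9) q by (simp add: field_simps)
  then have qm: "q < m" by simp
  have "real m < real (p * q)" using assms(10) q by (simp add: field_simps)
  then have mpq: "m < p * q" by (simp only: of_nat_less_iff)
  have cofactor: "q \<le> e" if "e dvd m" "e \<noteq> 1" for e
  proof -
    obtain r where "Factorial_Ring.prime r" "r dvd e"
      using prime_factor_nat[OF \<open>e \<noteq> 1\<close>] by blast
    then have "q \<le> r" using assms(8) that dvd_trans by blast
    moreover have "e > 0" using that qm by (cases e) auto
    then have "r \<le> e" using \<open>r dvd e\<close> by (simp add: dvd_imp_le)
    ultimately show ?thesis by simp
  qed
  \<comment> \<open>A proper divisor \<open>d\<close> has a cofactor different from 1, hence at
    least \<open>q\<close>; so \<open>d\<close> is at most \<open>m / q\<close>, which is below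
    \<open>p\<close>.\<close>
  have dvd_m: "d < p \<or> d = m" if "d dvd m" for d
  proof (cases "d = m")
    case False
    obtain e where e: "m = d * e" using \<open>d dvd m\<close> by (rule dvdE)
    then have "q \<le> e" using cofactor[of e] False by auto
    then have "d * q \<le> m" using e by simp
    then have "d * q < p * q" using mpq by linarith
    then show ?thesis by simp
  qed simp
  have m_less: "m < p\<^sup>2"
  proof -
    \<comment> \<open>\<open>q\<close> is itself a proper divisor of \<open>m\<close>, so the bound
      on proper divisors applies to it.\<close>
    have "q < p" using dvd_m[OF \<open>q dvd m\<close>] qm by simp
    then have "p * q \<le> p * p" by (intro mult_le_mono2) simp
    with mpq show ?thesis unfolding power2_eq_square by linarith
  qed
  have m_not_prime: "\<not> Factorial_Ring.prime m"
    using \<open>q dvd m\<close> q qm by (metis prime_nat_iff less_irrefl)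
  have "\<exists>H. subgroup H G \<and> card H * card (centralizer G H) > order G"
  proof (rule ccontr)
    assume "\<not> ?thesis"
    then interpret cd_bounded G m p k
      using assms dvd_m m_less m_not_prime by unfold_locales (auto simp: not_less)
    show False by (rule inconsistent)
  qed
  then obtain H where H: "subgroup H G" "cd_measure G H > order G"
    by (auto simp: cd_measure_def)
  \<comment> \<open>Finiteness of the set of measures makes \<open>Max\<close> an upper bound for
    it.\<close>
  have "{cd_measure G H |H. subgroup H G} \<subseteq> cd_measure G ` Pow (carrier G)"
    using subgroup.subset by blast
  then have "finite {cd_measure G H |H. subgroup H G}"
    using assms(2) by (meson finite_Pow_iff finite_imageI finite_subset)
  then have "cd_measure G H \<le> cd_max G" using H unfolding cd_max_def by (intro Max_ge) auto
  then have max: "cd_max G > order G" using H by simp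
  \<comment> \<open>The trivial subgroup has measure exactly \<open>order G\<close>, below the
    maximum, so it cannot belong to the lattice.\<close>
  have "cd_measure G {\<one>\<^bsub>G\<^esub>} = order G"
    by (auto simp: cd_measure_def centralizer_def order_def intro!: arg_cong[where f = card])
  then have "{\<one>\<^bsub>G\<^esub>} \<notin> CD_lattice G" using max by (simp add: CD_lattice_def)
  then show ?thesis using max by (auto simp: CD_simple_def)
qed

end
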